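(* Let $(G,\Gamma)$ be a connected $d$-periodic body-and-bar graph with $n=|V/\Gamma|=1$ and $m=|E/\Gamma|=d^2$, and let $C:E/\Gamma\to\mathbb{Z}^d$ be its lifting function. Then $(G,\Gamma)$ has infinitesimally rigid framework presentations in $\mathbb{R}^d$ if and only if for every set of equivalence classes of edges $F\subset E/\Gamma$, $$|F|\le d\cdot\dim(\mathrm{span}\,C(F)).$$
   Context: Periodic graphs. A $d$-periodic body-and-bar graph is a pair $(G,\Gamma)$, where $G=(V,E)$ is an infinite multigraph (edges join distinct vertices) and $\Gamma\subset \mathrm{Aut}(G)$ is a free Abelian group of rank $d$ acting without fixed points with finitely many vertex orbits and edge orbits. The quotient $G/\Gamma=(V/\Gamma,E/\Gamma)$ is a finite multigraph, possibly with loops, with $n=|V/\Gamma|$ vertices and $m=|E/\Gamma|$ edges. Frameworks. A presentation of $(G,\Gamma)$ in $\mathbb{R}^d$ consists of: an assignment $\tau:V\to SE(d)$, $\tau(i)=(p_i,M_i)$ with $p_i\in\mathbb{R}^d$, $M_i\in SO(d)$ (a Cartesian frame marking the rigid body $i$, acting by $x\mapsto M_ix+p_i$); an injective homomorphism $\pi$ from $\Gamma$ to the translations of $\mathbb{R}^d$ whose image is a lattice of rank $d$; and, for each edge $e=(i,j)$, attachment points $q^i(e),q^j(e)\in\mathbb{R}^d$ given in the coordinates of the bodies $i,j$, so that the bar $e$ has endpoints $M_iq^i+p_i$ and $M_jq^j+p_j$. The data are periodic: $\tau(\gamma i)=\pi(\gamma)\tau(i)$ and $q^{\gamma i}(\gamma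 e)=q^i(e)$ for $\gamma\in\Gamma$. A $d$-periodic body-and-bar framework is a connected $d$-periodic graph together with a presentation in which all bars have non-zero length. Lifting function and infinitesimal rigidity. Choose a basis of $\Gamma$ (so $\Gamma\cong\mathbb{Z}^d$) and let $\Lambda$ be the $d\times d$ matrix whose columns are the corresponding translation vectors. Choose representatives $1,\dots,n$ of the vertex orbits and an orientation of $G/\Gamma$; represent each edge orbit by the edge $e$ originating at a chosen vertex representative $i$, so that its other end is the translate of a representative $j$ by the period with coordinates $c=C(e)\in\mathbb{Z}^d$. This defines the lifting function $C:E/\Gamma\to\mathbb{Z}^d$; $C(F)$ denotes the image of $F$ and the span is taken in $\mathbb{R}^d$. Marking the bodies so that $p_i=0$, $M_i=I_d$ for all chosen representatives, the rigidity matrix is the matrix of the linear system, with one equation for each of the $m$ edge representatives, $$\langle \dot\Lambda c+A_jq^j-A_iq^i+\dot p_j-\dot p_i,\ \Lambda c+q^j-q^i\rangle=0$$ in the unknowns $\dot p_i\in\mathbb{R}^d$, $A_i\in\mathbb{R}^{d\times d}$ skew-symmetric ($i=1,\dots,n$) and $\dot\Lambda\in\mathbb{R}^{d\times d}$. The framework is infinitesimally rigid if this matrix has the maximal possible rank $\binom{d+1}{2}(n-1)+d^2$ (so $d^2$ when $n=1$), equivalently if the solution space is exactly the $\binom{d+1}{2}$-dimensional space of trivial infinitesimal motions coming from isometries of $\mathbb{R}^d$. *)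

theory Defs
  imports
    "HOL-Analysis.Analysis"
    "HOL-Algebra.Group_Action"
    "HOL-Algebra.Free_Abelian_Groups"
    "HOL-Library.Function_Algebras"
begin

section \<open>Periodic graphs\<close>

text \<open>
  Multigraphs are undirected: an edge is an abstract object with a set of two distinct end vertices.
\<close>

record ('v, 'e) multigraph =
  verts :: "'v set"
  edges :: "'e set"
  ends :: "'e \<Rightarrow> 'v set"

definition wf_multigraph :: "('v, 'e) multigraph \<Rightarrow> bool" where
  "wf_multigraph G \<longleftrightarrow> (\<forall>e\<in>edges G. ends G e \<subseteq> verts G \<and> card (ends G e) = 2)"

definition connected_multigraph :: "('v, 'e) multigraph \<Rightarrow> bool" where
  "connected_multigraph G \<longleftrightarrow>
     (\<forall>u\<in>verts G. \<forall>v\<in>verts G. (u, v) \<in> {(x, y). \<exists>e\<in>edges G. ends G e = {x, y}}\<^sup>*)"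

text \<open>
  An automorphism is a pair of permutations, one of the vertices and one of the edges.
  By \<open>permutes\<close> both are the identity outside the graph, so that automorphisms with the same
  effect on the graph are equal.
\<close>

type_synonym ('v, 'e) auto = "('v \<Rightarrow> 'v) \<times> ('e \<Rightarrow> 'e)"

definition aut_group :: "('v, 'e) multigraph \<Rightarrow> ('v, 'e) auto monoid" where
  "aut_group G =
     \<lparr> carrier = {(f, g). f permutes verts G \<and> g permutes edges G \<and>
                          (\<forall>e\<in>edges G. ends G (g e) = f ` ends G e)},
       monoid.mult = (\<lambda>(f, g) (f', g'). (f \<circ> f', g \<circ> g')),
       one = (id, id) \<rparr>"

abbreviation period_group :: "('v, 'e) multigraph \<Rightarrow> ('v, 'e) auto set \<Rightarrow> ('v, 'e) auto monoid" where
  "period_group G \<Gamma> \<equiv> (aut_group G)\<lparr>carrier := \<Gamma>\<rparr>"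

abbreviation vertex_orbit ::
    "('v, 'e) multigraph \<Rightarrow> ('v, 'e) auto set \<Rightarrow> 'v \<Rightarrow> 'v set" where
  "vertex_orbit G \<Gamma> v \<equiv> orbit (period_group G \<Gamma>) fst v"

abbreviation vertex_orbits :: "('v, 'e) multigraph \<Rightarrow> ('v, 'e) auto set \<Rightarrow> 'v set set" where
  "vertex_orbits G \<Gamma> \<equiv> orbits (period_group G \<Gamma>) (verts G) fst"

abbreviation edge_orbits :: "('v, 'e) multigraph \<Rightarrow> ('v, 'e) auto set \<Rightarrow> 'e set set" where
  "edge_orbits G \<Gamma> \<equiv> orbits (period_group G \<Gamma>) (edges G) snd"

text \<open>
  Fixed points are excluded for vertices only. For edges this follows: an automorphism in \<open>\<Gamma>\<close>
  fixing an edge has a square fixing both of its ends, and \<open>\<Gamma>\<close> is torsion-free.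
\<close>

definition periodic_graph ::
    "nat \<Rightarrow> ('v, 'e) multigraph \<Rightarrow> ('v, 'e) auto set \<Rightarrow> bool" where
  "periodic_graph d G \<Gamma> \<longleftrightarrow>
     wf_multigraph G \<and> infinite (verts G) \<and>
     subgroup \<Gamma> (aut_group G) \<and>
     period_group G \<Gamma> \<cong> free_Abelian_group {..<d} \<and>
     (\<forall>\<gamma>\<in>\<Gamma>. \<gamma> \<noteq> \<one>\<^bsub>aut_group G\<^esub> \<longrightarrow> (\<forall>v\<in>verts G. fst \<gamma> v \<noteq> v)) \<and>
     finite (vertex_orbits G \<Gamma>) \<and> finite (edge_orbits G \<Gamma>)"


section \<open>Frameworks\<close>

text \<open>The pair \<open>(p, M)\<close> stands for the rigid motion \<open>x \<mapsto> M x + p\<close>.\<close>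

definition SE :: "((real^'d) \<times> (real^'d^'d)) set" where
  "SE = {(p, M). rotation_matrix M}"

fun move :: "(real^'d) \<times> (real^'d^'d) \<Rightarrow> real^'d \<Rightarrow> real^'d" where
  "move (p, M) x = M *v x + p"

definition real_of_int_vec :: "int^'d \<Rightarrow> real^'d" where
  "real_of_int_vec c = (\<chi> k. real_of_int (c $ k))"

definition full_rank_lattice :: "(real^'d) set \<Rightarrow> bool" where
  "full_rank_lattice L \<longleftrightarrow>
     (\<exists>b :: 'd \<Rightarrow> real^'d. inj b \<and> independent (range b) \<and>
        L = range (\<lambda>c :: int^'d. \<Sum>k\<in>UNIV. of_int (c $ k) *\<^sub>R b k))"

text \<open>
  \<open>period P \<gamma>\<close> is the vector of the translation assigned to \<open>\<gamma>\<close>; \<open>attach P v e\<close>, for an end \<open>v\<close>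
  of \<open>e\<close>, is the attachment point of the bar \<open>e\<close> in the coordinates of the body \<open>v\<close>.
\<close>

record ('v, 'e, 'd) presentation =
  body :: "'v \<Rightarrow> (real^'d) \<times> (real^'d^'d)"
  period :: "('v, 'e) auto \<Rightarrow> real^'d"
  attach :: "'v \<Rightarrow> 'e \<Rightarrow> real^'d"

definition presentation_of ::
    "('v, 'e) multigraph \<Rightarrow> ('v, 'e) auto set \<Rightarrow> ('v, 'e, 'd::finite) presentation \<Rightarrow> bool" where
  "presentation_of G \<Gamma> P \<longleftrightarrow>
     (\<forall>v\<in>verts G. body P v \<in> SE) \<and>
     (\<forall>\<gamma>\<in>\<Gamma>. \<forall>\<delta>\<in>\<Gamma>. period P (\<gamma> \<otimes>\<^bsub>aut_group G\<^esub> \<delta>) = period P \<gamma> + period P \<delta>) \<and>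
     inj_on (period P) \<Gamma> \<and>
     full_rank_lattice (period P ` \<Gamma>) \<and>
     (\<forall>\<gamma>\<in>\<Gamma>. \<forall>v\<in>verts G.
        body P (fst \<gamma> v) = (fst (body P v) + period P \<gamma>, snd (body P v))) \<and>
     (\<forall>\<gamma>\<in>\<Gamma>. \<forall>e\<in>edges G. \<forall>v\<in>ends G e. attach P (fst \<gamma> v) (snd \<gamma> e) = attach P v e)"

definition framework ::
    "('v, 'e) multigraph \<Rightarrow> ('v, 'e) auto set \<Rightarrow> ('v, 'e, 'd::finite) presentation \<Rightarrow> bool" where
  "framework G \<Gamma> P \<longleftrightarrow>
     periodic_graph CARD('d) G \<Gamma> \<and> connected_multigraph G \<and> presentation_of G \<Gamma> P \<and>
     (\<forall>e\<in>edges G. \<forall>v w. ends G e = {v, w} \<longrightarrow>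
        move (body P v) (attach P v e) \<noteq> move (body P w) (attach P w e))"


section \<open>Lifting function and infinitesimal rigidity\<close>

text \<open>The element of \<open>\<Gamma>\<close> with integer coordinates \<open>c\<close> with respect to the family \<open>\<beta>\<close>.\<close>

definition lattice_element ::
    "('v, 'e) multigraph \<Rightarrow> ('v, 'e) auto set \<Rightarrow> ('d::finite \<Rightarrow> ('v, 'e) auto) \<Rightarrow> int^'d \<Rightarrow> ('v, 'e) auto"
  where
  "lattice_element G \<Gamma> \<beta> c =
     finprod (period_group G \<Gamma>) (\<lambda>k. \<beta> k [^]\<^bsub>period_group G \<Gamma>\<^esub> (c $ k)) UNIV"

definition period_basis ::
    "('v, 'e) multigraph \<Rightarrow> ('v, 'e) auto set \<Rightarrow> ('d::finite \<Rightarrow> ('v, 'e) auto) \<Rightarrow> bool" where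
  "period_basis G \<Gamma> \<beta> \<longleftrightarrow>
     range \<beta> \<subseteq> \<Gamma> \<and> (\<forall>\<gamma>\<in>\<Gamma>. \<exists>!c. \<gamma> = lattice_element G \<Gamma> \<beta> c)"

text \<open>
  A marking collects the choices entering the lifting function: a basis of \<open>\<Gamma>\<close>, a representative
  of each vertex orbit, and for each edge orbit an edge from \<open>origin\<close> to \<open>terminus\<close> that
  originates at a chosen vertex representative. The pair of origin and terminus carries the
  orientation of the edge in the quotient; for a loop, its reversal changes the representative edge.
\<close>

record ('v, 'e, 'd) marking =
  basis_of :: "'d \<Rightarrow> ('v, 'e) auto"
  vrep :: "'v set \<Rightarrow> 'v"
  erep :: "'e set \<Rightarrow> 'e"
  origin :: "'e set \<Rightarrow> 'v"
  terminus :: "'e set \<Rightarrow> 'v"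

definition marking_of ::
    "('v, 'e) multigraph \<Rightarrow> ('v, 'e) auto set \<Rightarrow> ('v, 'e, 'd::finite) marking \<Rightarrow> bool" where
  "marking_of G \<Gamma> X \<longleftrightarrow>
     period_basis G \<Gamma> (basis_of X) \<and>
     (\<forall>a\<in>vertex_orbits G \<Gamma>. vrep X a \<in> a) \<and>
     (\<forall>\<epsilon>\<in>edge_orbits G \<Gamma>. erep X \<epsilon> \<in> \<epsilon> \<and>
        ends G (erep X \<epsilon>) = {origin X \<epsilon>, terminus X \<epsilon>} \<and>
        origin X \<epsilon> \<in> vrep X ` vertex_orbits G \<Gamma>)"

definition lifting ::
    "('v, 'e) multigraph \<Rightarrow> ('v, 'e) auto set \<Rightarrow> ('v, 'e, 'd::finite) marking \<Rightarrow> 'e set \<Rightarrow> int^'d" where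
  "lifting G \<Gamma> X \<epsilon> =
     (THE c. terminus X \<epsilon> =
        fst (lattice_element G \<Gamma> (basis_of X) c) (vrep X (vertex_orbit G \<Gamma> (terminus X \<epsilon>))))"

text \<open>The columns are the translation vectors of the basis; \<open>$\<close> selects rows.\<close>

definition lattice_matrix ::
    "('v, 'e, 'd::finite) marking \<Rightarrow> ('v, 'e, 'd) presentation \<Rightarrow> real^'d^'d" where
  "lattice_matrix X P = transpose (\<chi> k. period P (basis_of X k))"

text \<open>
  The attachment point after the bodies have been re-marked so that every vertex representative
  gets the frame \<open>(0, I)\<close>, and hence its translate by \<open>\<gamma>\<close> the frame \<open>(period P \<gamma>, I)\<close>:
  by periodicity, \<open>move (body P v) q = period P \<gamma> + move (body P i) q\<close> if \<open>v\<close> is the translate of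
  the representative \<open>i\<close> by \<open>\<gamma>\<close>.
\<close>

definition marked_attach ::
    "('v, 'e) multigraph \<Rightarrow> ('v, 'e) auto set \<Rightarrow> ('v, 'e, 'd::finite) marking \<Rightarrow>
     ('v, 'e, 'd) presentation \<Rightarrow> 'v \<Rightarrow> 'e \<Rightarrow> real^'d" where
  "marked_attach G \<Gamma> X P v e = move (body P (vrep X (vertex_orbit G \<Gamma> v))) (attach P v e)"

text \<open>
  The left-hand side of the equation of the edge orbit \<open>\<epsilon>\<close>, at the unknowns \<open>p'\<close>, \<open>A\<close> (indexed by
  vertex orbits) and \<open>L'\<close>, the velocity of the lattice matrix.
\<close>

definition rigidity_form ::
    "('v, 'e) multigraph \<Rightarrow> ('v, 'e) auto set \<Rightarrow> ('v, 'e, 'd::finite) marking \<Rightarrow>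
     ('v, 'e, 'd) presentation \<Rightarrow>
     ('v set \<Rightarrow> real^'d) \<Rightarrow> ('v set \<Rightarrow> real^'d^'d) \<Rightarrow> real^'d^'d \<Rightarrow> 'e set \<Rightarrow> real" where
  "rigidity_form G \<Gamma> X P p' A L' \<epsilon> =
     (let i = vertex_orbit G \<Gamma> (origin X \<epsilon>);
          j = vertex_orbit G \<Gamma> (terminus X \<epsilon>);
          c = real_of_int_vec (lifting G \<Gamma> X \<epsilon>);
          q\<^sub>i = marked_attach G \<Gamma> X P (origin X \<epsilon>) (erep X \<epsilon>);
          q\<^sub>j = marked_attach G \<Gamma> X P (terminus X \<epsilon>) (erep X \<epsilon>)
      in (L' *v c + A j *v q\<^sub>j - A i *v q\<^sub>i + p' j - p' i)
           \<bullet> (lattice_matrix X P *v c + q\<^sub>j - q\<^sub>i))"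

text \<open>
  The column space of the rigidity matrix, that is, the set of all values of the linear system
  on the space of unknowns. Its elements are vectors with one entry for each edge orbit, written
  as functions that vanish elsewhere.
\<close>

definition rigidity_range ::
    "('v, 'e) multigraph \<Rightarrow> ('v, 'e) auto set \<Rightarrow> ('v, 'e, 'd::finite) marking \<Rightarrow>
     ('v, 'e, 'd) presentation \<Rightarrow> ('e set \<Rightarrow> real) set" where
  "rigidity_range G \<Gamma> X P =
     {(\<lambda>\<epsilon>. if \<epsilon> \<in> edge_orbits G \<Gamma> then rigidity_form G \<Gamma> X P p' A L' \<epsilon> else 0) | p' A L'.
        \<forall>a\<in>vertex_orbits G \<Gamma>. transpose (A a) = - A a}"

definition rigidity_rank ::
    "('v, 'e) multigraph \<Rightarrow> ('v, 'e) auto set \<Rightarrow> ('v, 'e, 'd::finite) marking \<Rightarrow>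
     ('v, 'e, 'd) presentation \<Rightarrow> nat" where
  "rigidity_rank G \<Gamma> X P =
     vector_space.dim (\<lambda>r f \<epsilon>. r * f \<epsilon> :: real) (rigidity_range G \<Gamma> X P)"

definition infinitesimally_rigid ::
    "('v, 'e) multigraph \<Rightarrow> ('v, 'e) auto set \<Rightarrow> ('v, 'e, 'd::finite) marking \<Rightarrow>
     ('v, 'e, 'd) presentation \<Rightarrow> bool" where
  "infinitesimally_rigid G \<Gamma> X P \<longleftrightarrow>
     rigidity_rank G \<Gamma> X P =
       (CARD('d) + 1 choose 2) * (card (vertex_orbits G \<Gamma>) - 1) + CARD('d)\<^sup>2"

end

theory Submission
  imports Defs
begin

text \<open>
  With a single vertex orbit the velocities \<open>p'\<close> cancel, and the skew-symmetric matrix \<open>A\<close> can be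
  absorbed into \<open>L'\<close> because \<open>A x\<close> is orthogonal to \<open>x\<close>. If \<open>b\<close> denotes the vector of a bar, its
  equation becomes \<open>(M c) \<bullet> b = M \<bullet> (b \<otimes> c) = 0\<close> with \<open>M = L' - A \<Lambda>\<close> arbitrary, so the rank of the
  rigidity matrix is the dimension of the span of the tensors \<open>b \<otimes> c\<close>. The bar vectors can be
  chosen freely through the attachment points, so the question is whether some choice makes these
  tensors linearly independent. Those belonging to \<open>F\<close> lie in a space of dimension
  \<open>d * dim (span C(F))\<close>, which gives necessity. For sufficiency, Rado's theorem on independent
  transversals selects one tensor from each of the sets \<open>{e\<^sub>1 \<otimes> c, \<dots>, e\<^sub>d \<otimes> c}\<close>; it asks that the sets
  belonging to \<open>F\<close> together span at least \<open>card F\<close> dimensions, which is the counting condition.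
\<close>

section \<open>Independent transversals\<close>

text \<open>The dimension formula for the sum and intersection of the two spans. \<open>U\<close>
  stands for a common part, which lies in that intersection.\<close>

lemma dim_Un_submodular:
  fixes S T U :: "'a::euclidean_space set"
  assumes "U \<subseteq> span S" "U \<subseteq> span T"
  shows "dim (S \<union> T) + dim U \<le> dim S + dim T"
proof -
  have "dim {x + y |x y. x \<in> span S \<and> y \<in> span T} + dim (span S \<inter> span T) = dim (span S) + dim (span T)"
    by (rule dim_sums_Int) auto
  moreover have "dim (S \<union> T) = dim {x + y |x y. x \<in> span S \<and> y \<in> span T}"
    using dim_span[of "S \<union> T"] by (simp only: span_Un)
  moreover have "dim U \<le> dim (span S \<inter> span T)"
    using assms by (intro dim_subset) auto
  ultimately show ?thesis by simp
qed

text \<open>Induction on the total size of the sets. While some set has two elements, one of them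
  can be deleted without breaking the rank condition; once all sets are singletons, the condition
  for \<open>I\<close> itself is the claim. As \<open>dim\<close> never exceeds the number of
  distinct vectors, the conclusion says both that the choice is injective on \<open>I\<close> and
  that its values are independent.\<close>

lemma rado_independent_transversal:
  fixes A :: "'i \<Rightarrow> 'a::euclidean_space set"
  assumes "finite I" and "\<And>i. i \<in> I \<Longrightarrow> finite (A i)"
    and "\<And>F. F \<subseteq> I \<Longrightarrow> card F \<le> dim (\<Union>i\<in>F. A i)"
  shows "\<exists>x. (\<forall>i\<in>I. x i \<in> A i) \<and> card I \<le> dim (x ` I)"
  using assms(2,3)
proof (induction "\<Sum>i\<in>I. card (A i)" arbitrary: A rule: less_induct)
  case less
  have finF: "finite F" if "F \<subseteq> I" for F
    using that \<open>finite I\<close> by (rule finite_subset)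
  have ne: "A i \<noteq> {}" if "i \<in> I" for i
    using less.prems(2)[of "{i}"] that by auto
  show ?case
  proof (cases "\<exists>i\<in>I. \<exists>x\<in>A i. \<exists>y\<in>A i. x \<noteq> y")
    case True
    then obtain i x y where i: "i \<in> I" and xy: "x \<in> A i" "y \<in> A i" "x \<noteq> y" by blast
    define del where "del z = A(i := A i - {z})" for z
    \<comment> \<open>A harmless deletion leaves a smaller family, and a transversal of that family
      is also one of \<open>A\<close>.\<close>
    have *: "\<exists>x. (\<forall>i\<in>I. x i \<in> A i) \<and> card I \<le> dim (x ` I)"
      if z: "z \<in> A i" and rado: "\<And>F. F \<subseteq> I \<Longrightarrow> card F \<le> dim (\<Union>j\<in>F. del z j)" for z
    proof -
      have fin: "finite (del z j)" if "j \<in> I" for j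
        using less.prems(1)[OF that] by (auto simp: del_def)
      have "(\<Sum>j\<in>I. card (del z j)) < (\<Sum>j\<in>I. card (A j))"
      proof (rule sum_strict_mono_ex1[OF \<open>finite I\<close>])
        show "\<forall>j\<in>I. card (del z j) \<le> card (A j)"
          using less.prems(1) by (auto simp: del_def intro!: card_mono)
        show "\<exists>j\<in>I. card (del z j) < card (A j)"
          using i z less.prems(1)[OF i]
          by (intro bexI[of _ i])
            (auto simp: del_def intro!: psubset_card_mono
               simp del: card_Diff_insert card_Diff_singleton)
      qed
      then obtain w where "\<forall>j\<in>I. w j \<in> del z j" "card I \<le> dim (w ` I)"
        using less.hyps[of "del z", OF _ _ rado] fin by blast
      then show ?thesis
        by (intro exI[of _ w]) (auto simp: del_def split: if_splits)
    qed
    \<comment> \<open>A set violating the condition after deleting \<open>z\<close> must contain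
      \<open>i\<close>, since nothing else has changed. Dropping \<open>i\<close> from it turns the
      strict inequality into a weak one.\<close>
    have viol: "\<exists>F. F \<subseteq> I \<and> i \<notin> F \<and> dim (A i - {z} \<union> (\<Union>j\<in>F. A j)) \<le> card F"
      if nr: "\<not> (\<forall>F\<subseteq>I. card F \<le> dim (\<Union>j\<in>F. del z j))" for z
    proof -
      obtain F where F: "F \<subseteq> I" "dim (\<Union>j\<in>F. del z j) < card F"
        using nr by (auto simp: not_le)
      have "i \<in> F"
      proof (rule ccontr)
        assume "i \<notin> F"
        then have "(\<Union>j\<in>F. del z j) = (\<Union>j\<in>F. A j)" by (auto simp: del_def split: if_splits)
        then show False using F less.prems(2)[of F] by simp
      qed
      then have "(\<Union>j\<in>F. del z j) = A i - {z} \<union> (\<Union>j\<in>F - {i}. A j)"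
        by (auto simp: del_def split: if_splits)
      moreover have "card F = Suc (card (F - {i}))"
        using \<open>i \<in> F\<close> finF[OF F(1)] by (metis card.remove)
      ultimately show ?thesis using F by (intro exI[of _ "F - {i}"]) auto
    qed
    text \<open>
      Either \<open>x\<close> or \<open>y\<close> can be deleted from \<open>A i\<close>: two violating sets would contradict the
      submodularity of \<open>dim\<close>, because their unions together recover all of \<open>A i\<close>.
    \<close>
    show ?thesis
    proof (rule ccontr)
      assume no: "\<not> ?thesis"
      obtain F where F: "F \<subseteq> I" "i \<notin> F" "dim (A i - {x} \<union> (\<Union>j\<in>F. A j)) \<le> card F"
        using viol[of x] *[OF xy(1)] no by blast
      obtain H where H: "H \<subseteq> I" "i \<notin> H" "dim (A i - {y} \<union> (\<Union>j\<in>H. A j)) \<le> card H"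
        using viol[of y] *[OF xy(2)] no by blast
      let ?P = "A i - {x} \<union> (\<Union>j\<in>F. A j)" and ?Q = "A i - {y} \<union> (\<Union>j\<in>H. A j)"
      have "card (insert i (F \<union> H)) \<le> dim (\<Union>j\<in>insert i (F \<union> H). A j)"
        using i F H by (intro less.prems(2)) auto
      also have "(\<Union>j\<in>insert i (F \<union> H). A j) = ?P \<union> ?Q"
        using xy by auto
      finally have "card (insert i (F \<union> H)) \<le> dim (?P \<union> ?Q)" .
      moreover have "card (F \<inter> H) \<le> dim (\<Union>j\<in>F \<inter> H. A j)"
        using F by (intro less.prems(2)) auto
      moreover have "dim (?P \<union> ?Q) + dim (\<Union>j\<in>F \<inter> H. A j) \<le> dim ?P + dim ?Q"
        by (intro dim_Un_submodular) (auto intro: span_base)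
      moreover have "card (insert i (F \<union> H)) = Suc (card (F \<union> H))"
        using F H finF by simp
      moreover have "card F + card H = card (F \<union> H) + card (F \<inter> H)"
        using F H finF by (intro card_Un_Int) auto
      \<comment> \<open>Submodularity bounds the two ranks from above by
        \<open>card F + card H\<close>, whereas the rank condition bounds them from below by
        \<open>card F + card H + 1\<close>; the extra 1 is the element \<open>i\<close>.\<close>
      ultimately show False using F(3) H(3) by linarith
    qed
  next
    case False
    then have sing: "A i = {SOME x. x \<in> A i}" if "i \<in> I" for i
      using some_in_eq[of "A i"] ne[OF that] that by blast
    then have "(\<Union>i\<in>I. A i) = (\<lambda>i. SOME x. x \<in> A i) ` I" by blast
    then show ?thesis
      using less.prems(2)[OF order_refl] ne
      by (intro exI[of _ "\<lambda>i. SOME x. x \<in> A i"]) (simp add: some_in_eq)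
  qed
qed

section \<open>Outer products\<close>

text \<open>The matrix of rank at most one b c^T, standing for the tensor b \<otimes> c.\<close>

definition outer :: "real^'m \<Rightarrow> real^'n \<Rightarrow> real^'n^'m" where
  "outer b c = (\<chi> i. b $ i *\<^sub>R c)"

text \<open>Turns an equation that is linear in the unknown matrix \<open>M\<close> into the
  entrywise inner product of \<open>M\<close> with a fixed tensor.\<close>

lemma inner_outer: "M \<bullet> outer b c = (M *v c) \<bullet> b"
  by (simp add: outer_def inner_vec_def matrix_vector_mult_def sum_distrib_left sum_distrib_right mult_ac)

lemma linear_outer_right: "linear (outer b)"
  by (rule linearI) (simp_all add: outer_def vec_eq_iff algebra_simps)

lemma outer_sum_axis: "outer b c = (\<Sum>k\<in>UNIV. b $ k *\<^sub>R outer (axis k 1) c)"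
  by (simp add: outer_def vec_eq_iff axis_def if_distrib if_distribR sum.delta' cong: if_cong)

text \<open>For a basis \<open>B\<close> of the span of \<open>S\<close>, the tensors of unit
  vectors with elements of \<open>B\<close> form a basis of \<real>^m \<otimes> span S.\<close>

lemma dim_outer_axis:
  fixes S :: "(real^'n) set"
  shows "dim (\<Union>c\<in>S. range (\<lambda>k::'m::finite. outer (axis k 1) c)) = CARD('m) * dim S"
proof -
  obtain B where B: "B \<subseteq> S" "independent B" "S \<subseteq> span B" "card B = dim S"
    using basis_exists by blast
  let ?f = "\<lambda>(k::'m, c). outer (axis k 1) c"
  have row: "outer (axis k 1) c $ i = (if i = k then c else 0)" for i k :: 'm and c :: "real^'n"
    by (simp add: outer_def axis_def)
  have nz: "c \<noteq> 0" if "c \<in> B" for c using B(2) that dependent_zero by blast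
  have inj: "inj_on ?f (UNIV \<times> B)"
  proof (rule inj_onI, clarify)
    fix k c l c'
    assume "c \<in> B" "c' \<in> B" and eq: "outer (axis k 1) c = outer (axis (l::'m) 1) c'"
    then show "k = l \<and> c = c'"
      using arg_cong[OF eq, of "\<lambda>M. M $ k"] nz[of c] row[of k c k] row[of l c' k]
      by (auto split: if_splits)
  qed
  have indep: "independent (?f ` (UNIV \<times> B))"
    unfolding dependent_def
  proof (clarify)
    fix k c
    assume c: "c \<in> B" and mem: "outer (axis (k::'m) 1) c \<in> span (?f ` (UNIV \<times> B) - {outer (axis k 1) c})"
    have lin: "linear (\<lambda>M :: real^'n^'m. M $ k)"
      by (rule linearI) simp_all
    \<comment> \<open>Projecting to row \<open>k\<close> sends the tensor in question to
      \<open>c\<close> and each of the others to 0 or to an element of \<open>B\<close> other than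
      \<open>c\<close>, so a dependence among the tensors would yield one in
      \<open>B\<close>.\<close>
    have "c \<in> (\<lambda>M. M $ k) ` span (?f ` (UNIV \<times> B) - {outer (axis k 1) c})"
      using mem row[of k c k] by (metis imageI)
    also have "\<dots> = span ((\<lambda>M. M $ k) ` (?f ` (UNIV \<times> B) - {outer (axis k 1) c}))"
      using lin by (simp add: linear_span_image)
    also have "\<dots> \<subseteq> span (insert 0 (B - {c}))"
    proof (intro span_mono image_subsetI)
      fix M assume "M \<in> ?f ` (UNIV \<times> B) - {outer (axis k 1) c}"
      then obtain l c' where "c' \<in> B" "M = outer (axis (l::'m) 1) c'" "M \<noteq> outer (axis k 1) c"
        by auto
      then show "M $ k \<in> insert 0 (B - {c})" by (cases "k = l") (auto simp: row)
    qed
    finally show False using B(2) c by (auto simp: dependent_def)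
  qed
  have "span (\<Union>c\<in>S. range (\<lambda>k::'m. outer (axis k 1) c)) = span (?f ` (UNIV \<times> B))"
  proof (rule span_eq[THEN iffD2], intro conjI)
    show "(\<Union>c\<in>S. range (\<lambda>k::'m. outer (axis k 1) c)) \<subseteq> span (?f ` (UNIV \<times> B))"
    proof clarify
      fix k :: 'm and c assume "c \<in> S"
      then have "outer (axis k 1) c \<in> outer (axis k 1) ` span B" using B by auto
      also have "\<dots> = span (outer (axis k 1) ` B)"
        by (simp add: linear_span_image[OF linear_outer_right])
      also have "\<dots> \<subseteq> span (?f ` (UNIV \<times> B))" by (intro span_mono) auto
      finally show "outer (axis k 1) c \<in> span (?f ` (UNIV \<times> B))" .
    qed
    show "?f ` (UNIV \<times> B) \<subseteq> span (\<Union>c\<in>S. range (\<lambda>k::'m. outer (axis k 1) c))"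
      using B(1) by (auto intro!: span_base)
  qed
  then have "dim (\<Union>c\<in>S. range (\<lambda>k::'m. outer (axis k 1) c)) = card (?f ` (UNIV \<times> B))"
    by (metis dim_span dim_eq_card_independent[OF indep])
  also have "\<dots> = CARD('m) * dim S"
    using inj B(4) by (simp add: card_image card_cartesian_product)
  finally show ?thesis .
qed

text \<open>Tensors indexed by \<open>F\<close> lie in \<real>^m \<otimes> span c(F), whose
  dimension is the right-hand side, and they inherit independence from the whole family.\<close>

lemma card_le_dim_if_independent_outer:
  fixes b :: "'i \<Rightarrow> real^'m" and c :: "'i \<Rightarrow> real^'n"
  assumes "finite E" and b: "dim ((\<lambda>e. outer (b e) (c e)) ` E) = card E" and F: "F \<subseteq> E"
  shows "card F \<le> CARD('m) * dim (c ` F)"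
proof -
  let ?t = "\<lambda>e. outer (b e) (c e)"
  \<comment> \<open>The rank is at most the number of distinct tensors, which is at most
    \<open>card E\<close>. Equality throughout rules out that two indices share a tensor, so
    counting tensors counts indices.\<close>
  have "card (?t ` E) = card E"
    using b dim_le_card'[of "?t ` E"] card_image_le[OF \<open>finite E\<close>, of ?t] \<open>finite E\<close> by simp
  then have inj: "inj_on ?t E" using \<open>finite E\<close> by (simp add: eq_card_imp_inj_on)
  have indep: "independent (?t ` E)"
    using b \<open>finite E\<close>
    by (intro card_le_dim_spanning[of _ "span (?t ` E)"])
      (auto simp: span_superset \<open>card (?t ` E) = card E\<close>)
  have "card F = card (?t ` F)" using inj F by (metis card_image inj_on_subset)
  also have "\<dots> = dim (?t ` F)"
    using independent_mono[OF indep image_mono[OF F]] by (simp add: dim_eq_card_independent)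
  also have "\<dots> \<le> dim (\<Union>v\<in>c ` F. range (\<lambda>k::'m. outer (axis k 1) v))"
  proof (rule dim_mono, clarify)
    fix e assume "e \<in> F"
    then show "?t e \<in> span (\<Union>v\<in>c ` F. range (\<lambda>k::'m. outer (axis k 1) v))"
      unfolding outer_sum_axis[of "b e"] by (intro span_sum span_scale span_base) blast
  qed
  finally show ?thesis by (simp only: dim_outer_axis)
qed

text \<open>Rado's theorem for the sets of tensors of unit vectors with \<open>c e\<close>; by
  \<open>dim_outer_axis\<close> its rank condition is the counting condition. The vectors
  \<open>b e\<close> found in this way are unit vectors, so they can serve as bars of non-zero
  length.\<close>

lemma ex_independent_outer:
  fixes c :: "'i \<Rightarrow> real^'n"
  assumes "finite E" and cond: "\<And>F. F \<subseteq> E \<Longrightarrow> card F \<le> CARD('m) * dim (c ` F)"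
  obtains b :: "'i \<Rightarrow> real^'m"
    where "\<And>e. b e \<noteq> 0" "dim ((\<lambda>e. outer (b e) (c e)) ` E) = card E"
proof -
  have "\<exists>x. (\<forall>e\<in>E. x e \<in> range (\<lambda>k::'m. outer (axis k 1) (c e))) \<and> card E \<le> dim (x ` E)"
  proof (rule rado_independent_transversal[OF \<open>finite E\<close>])
    fix F assume "F \<subseteq> E"
    then show "card F \<le> dim (\<Union>e\<in>F. range (\<lambda>k::'m. outer (axis k 1) (c e)))"
      using cond dim_outer_axis[of "c ` F", where 'm='m] by simp
  qed simp
  then obtain x where x: "\<And>e. e \<in> E \<Longrightarrow> x e \<in> range (\<lambda>k::'m. outer (axis k 1) (c e))" "card E \<le> dim (x ` E)"
    by blast
  then have "\<forall>e\<in>E. \<exists>k::'m. x e = outer (axis k 1) (c e)" by blast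
  then obtain k :: "'i \<Rightarrow> 'm" where k: "\<And>e. e \<in> E \<Longrightarrow> x e = outer (axis (k e) 1) (c e)" by metis
  have "dim (x ` E) \<le> card E"
    using dim_le_card'[of "x ` E"] card_image_le[OF \<open>finite E\<close>, of x] \<open>finite E\<close> by simp
  then have "dim ((\<lambda>e. outer (axis (k e) 1) (c e)) ` E) = card E"
    using x(2) k by (simp cong: image_cong)
  then show thesis
    by (intro that[of "\<lambda>e. axis (k e) 1"]) (simp_all add: axis_eq_0_iff)
qed

text \<open>Column rank equals row rank: the evaluation map vanishes on the orthogonal complement of
  the span of the vectors \<open>t e\<close> and is injective on that span.\<close>

lemma dim_evaluations:
  fixes t :: "'i \<Rightarrow> 'a::euclidean_space"
  shows "vector_space.dim (\<lambda>r f e. r * f e :: real)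
     (range (\<lambda>M e. if e \<in> E then M \<bullet> t e else 0)) = dim (t ` E)"
proof -
  let ?s = "\<lambda>r (f :: 'i \<Rightarrow> real) e. r * f e"
  let ?T = "\<lambda>M e. if e \<in> E then M \<bullet> t e else 0"
  interpret V: vector_space ?s
    by unfold_locales (simp_all add: plus_fun_def algebra_simps)
  interpret P: finite_dimensional_vector_space_pair_1 "scaleR :: real \<Rightarrow> 'a \<Rightarrow> 'a" Basis ?s
    by unfold_locales
  have lin: "Vector_Spaces.linear scaleR ?s ?T"
    by unfold_locales (simp_all add: fun_eq_iff plus_fun_def algebra_simps inner_add_left)
  have orth0: "M = 0" if "M \<in> span (t ` E)" "\<And>e. e \<in> E \<Longrightarrow> M \<bullet> t e = 0" for M
  proof -
    have "orthogonal M M"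
      using orthogonal_to_span[OF that(1), of M] that(2) by (auto simp: orthogonal_def)
    then show ?thesis by (simp add: orthogonal_def)
  qed
  \<comment> \<open>Only the component of \<open>M\<close> inside the span contributes to the inner
    products with the vectors \<open>t e\<close>.\<close>
  have "range ?T = ?T ` span (t ` E)"
  proof safe
    fix M
    obtain y z where yz: "y \<in> span (t ` E)" "\<And>w. w \<in> span (t ` E) \<Longrightarrow> orthogonal z w" "M = y + z"
      using orthogonal_subspace_decomp_exists[of "t ` E" M] by metis
    then have "?T M = ?T y"
      by (auto simp: fun_eq_iff inner_add_left orthogonal_def span_base)
    then show "?T M \<in> ?T ` span (t ` E)" using yz(1) by blast
  qed auto
  moreover have "inj_on ?T (span (span (t ` E)))"
  proof (rule inj_onI)
    fix M N assume MN: "M \<in> span (span (t ` E))" "N \<in> span (span (t ` E))" and eq: "?T M = ?T N"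
    have "(M - N) \<bullet> t e = 0" if "e \<in> E" for e
      using fun_cong[OF eq, of e] that by (simp add: inner_diff_left)
    moreover have "M - N \<in> span (t ` E)" using MN by (simp add: span_diff span_span)
    ultimately show "M = N" using orth0[of "M - N"] by simp
  qed
  ultimately show ?thesis
    using P.dim_image_eq[OF lin, of "span (t ` E)"]
    unfolding span_raw_def[symmetric] dim_raw_def[symmetric] by simp
qed

section \<open>The rank of the rigidity matrix\<close>

text \<open>The second factor of \<open>rigidity_form\<close>. In a presentation it is the vector of
  the representative bar, from origin to terminus.\<close>

definition bar_vector ::
    "('v, 'e) multigraph \<Rightarrow> ('v, 'e) auto set \<Rightarrow> ('v, 'e, 'd::finite) marking \<Rightarrow>
     ('v, 'e, 'd) presentation \<Rightarrow> 'e set \<Rightarrow> real^'d" where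
  "bar_vector G \<Gamma> X P \<epsilon> =
     lattice_matrix X P *v real_of_int_vec (lifting G \<Gamma> X \<epsilon>)
       + marked_attach G \<Gamma> X P (terminus X \<epsilon>) (erep X \<epsilon>)
       - marked_attach G \<Gamma> X P (origin X \<epsilon>) (erep X \<epsilon>)"

lemma skew_inner_eq_0:
  fixes A :: "real^'n^'n"
  assumes "transpose A = - A"
  shows "(A *v x) \<bullet> x = 0"
proof -
  have "(A *v x) \<bullet> x = x \<bullet> (transpose A *v x)"
    by (simp add: dot_lmul_matrix transpose_matrix_vector inner_commute[of x])
  also have "transpose A *v x = - (A *v x)" 
    using matrix_vector_mult_diff_rdistrib[of 0 A x] by (simp add: assms)
  finally show ?thesis by (simp add: inner_commute)
qed

text \<open>Both ends of every bar carry the same unknowns, those of the orbit \<open>a\<close>, so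
  the form depends only on the matrix \<open>L' - A a ** lattice_matrix X P\<close>, and by
  \<open>dim_evaluations\<close> the rank is the dimension of the span of the tensors.\<close>

lemma rigidity_rank_eq_dim:
  fixes X :: "('v, 'e, 'd::finite) marking"
  assumes "\<And>\<epsilon>. \<epsilon> \<in> edge_orbits G \<Gamma> \<Longrightarrow>
      vertex_orbit G \<Gamma> (origin X \<epsilon>) = a \<and> vertex_orbit G \<Gamma> (terminus X \<epsilon>) = a"
    and "a \<in> vertex_orbits G \<Gamma>"
  shows "rigidity_rank G \<Gamma> X P =
     dim ((\<lambda>\<epsilon>. outer (bar_vector G \<Gamma> X P \<epsilon>) (real_of_int_vec (lifting G \<Gamma> X \<epsilon>))) ` edge_orbits G \<Gamma>)"
proof -
  let ?c = "\<lambda>\<epsilon>. real_of_int_vec (lifting G \<Gamma> X \<epsilon>)" and ?b = "bar_vector G \<Gamma> X P"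
  have form: "rigidity_form G \<Gamma> X P p' A L' \<epsilon> = (L' - A a ** lattice_matrix X P) \<bullet> outer (?b \<epsilon>) (?c \<epsilon>)"
    if "\<epsilon> \<in> edge_orbits G \<Gamma>" "transpose (A a) = - A a" for p' A L' \<epsilon>
  proof -
    let ?q = "\<lambda>v. marked_attach G \<Gamma> X P v (erep X \<epsilon>)"
    \<comment> \<open>Substituting this into the rotation term leaves a multiple of the period,
      absorbed into \<open>L'\<close>, and \<open>A a\<close> applied to the bar, which is
      orthogonal to the bar.\<close>
    have q: "?q (terminus X \<epsilon>) - ?q (origin X \<epsilon>) = ?b \<epsilon> - lattice_matrix X P *v ?c \<epsilon>"
      by (simp add: bar_vector_def)
    have "rigidity_form G \<Gamma> X P p' A L' \<epsilon>
        = (L' *v ?c \<epsilon> + A a *v (?q (terminus X \<epsilon>) - ?q (origin X \<epsilon>))) \<bullet> ?b \<epsilon>"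
      using assms(1)[OF that(1)]
      by (simp add: rigidity_form_def Let_def bar_vector_def algebra_simps matrix_vector_mult_diff_distrib)
    also have "\<dots> = ((L' - A a ** lattice_matrix X P) *v ?c \<epsilon>) \<bullet> ?b \<epsilon> + (A a *v ?b \<epsilon>) \<bullet> ?b \<epsilon>"
      unfolding q
      by (simp add: algebra_simps inner_add_left inner_diff_left matrix_vector_mult_diff_distrib
          matrix_vector_mult_diff_rdistrib matrix_vector_mul_assoc)
    finally show ?thesis
      using skew_inner_eq_0[OF that(2)] by (simp add: inner_outer)
  qed
  have "rigidity_range G \<Gamma> X P
      = range (\<lambda>M \<epsilon>. if \<epsilon> \<in> edge_orbits G \<Gamma> then M \<bullet> outer (?b \<epsilon>) (?c \<epsilon>) else 0)" (is "?L = range ?T")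
  proof
    show "?L \<subseteq> range ?T"
    proof
      fix f assume "f \<in> ?L"
      then obtain p' A L' where A: "\<forall>a\<in>vertex_orbits G \<Gamma>. transpose (A a) = - A a"
        and f: "f = (\<lambda>\<epsilon>. if \<epsilon> \<in> edge_orbits G \<Gamma> then rigidity_form G \<Gamma> X P p' A L' \<epsilon> else 0)"
        unfolding rigidity_range_def by blast
      have "f = ?T (L' - A a ** lattice_matrix X P)"
        using A assms(2) by (simp add: f form fun_eq_iff)
      then show "f \<in> range ?T" by blast
    qed
    show "range ?T \<subseteq> ?L"
    proof
      fix f assume "f \<in> range ?T"
      then obtain M where f: "f = ?T M" by blast
      have sk: "transpose (0::real^'d^'d) = - 0" by (simp add: transpose_def vec_eq_iff)
      \<comment> \<open>Every matrix arises: take zero rotations and \<open>M\<close> itself as the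
        velocity of the lattice matrix.\<close>
      have "?T M = (\<lambda>\<epsilon>. if \<epsilon> \<in> edge_orbits G \<Gamma> then rigidity_form G \<Gamma> X P (\<lambda>_. 0) (\<lambda>_. 0) M \<epsilon> else 0)"
        using sk by (simp add: form fun_eq_iff)
      then show "f \<in> ?L" unfolding rigidity_range_def f using sk by blast
    qed
  qed
  then show ?thesis unfolding rigidity_rank_def by (simp only: dim_evaluations)
qed


section \<open>The group of periods\<close>

lemma mult_aut_group: "\<gamma> \<otimes>\<^bsub>aut_group G\<^esub> \<delta> = (fst \<gamma> \<circ> fst \<delta>, snd \<gamma> \<circ> snd \<delta>)"
  by (simp add: aut_group_def case_prod_unfold)

lemma one_aut_group: "\<one>\<^bsub>aut_group G\<^esub> = (id, id)"
  by (simp add: aut_group_def)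

lemma group_aut_group: "group (aut_group G)"
proof (rule groupI)
  fix x assume x: "x \<in> carrier (aut_group G)"
  obtain f g where fg: "x = (f, g)" by force
  have perm: "f permutes verts G" "g permutes edges G"
    and ends: "\<And>e. e \<in> edges G \<Longrightarrow> ends G (g e) = f ` ends G e"
    using x by (auto simp: fg aut_group_def)
  have "ends G (Hilbert_Choice.inv g e) = Hilbert_Choice.inv f ` ends G e" if "e \<in> edges G" for e
  proof -
    have "ends G e = f ` ends G (Hilbert_Choice.inv g e)"
      using ends[of "Hilbert_Choice.inv g e"] that perm(2)
      by (simp add: permutes_in_image[OF permutes_inv] permutes_inverses)
    then show ?thesis
      using perm(1) by (simp add: image_comp permutes_inv_o)
  qed
  then have "(Hilbert_Choice.inv f, Hilbert_Choice.inv g) \<in> carrier (aut_group G)"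
    using perm by (auto simp: aut_group_def permutes_inv)
  moreover have "(Hilbert_Choice.inv f, Hilbert_Choice.inv g) \<otimes>\<^bsub>aut_group G\<^esub> x = \<one>\<^bsub>aut_group G\<^esub>"
    using perm by (simp add: fg mult_aut_group one_aut_group permutes_inv_o)
  ultimately show "\<exists>y\<in>carrier (aut_group G). y \<otimes>\<^bsub>aut_group G\<^esub> x = \<one>\<^bsub>aut_group G\<^esub>" by blast
next
  fix x y assume "x \<in> carrier (aut_group G)" "y \<in> carrier (aut_group G)"
  then show "x \<otimes>\<^bsub>aut_group G\<^esub> y \<in> carrier (aut_group G)"
    by (auto simp: aut_group_def permutes_compose permutes_in_image image_comp)
qed (auto simp: mult_aut_group one_aut_group o_assoc, auto simp: aut_group_def permutes_id)

text \<open>Both properties are pulled back along an injective homomorphism into integer-valued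
  functions under addition. Squares suffice for torsion, because a period fixing an edge can at
  worst swap its two ends.\<close>

lemma
  assumes "group H" "H \<cong> free_Abelian_group S"
  shows iso_free_Abelian_group_comm: "comm_group H"
    and iso_free_Abelian_group_torsion_free: "\<And>x. x \<in> carrier H \<Longrightarrow> x \<otimes>\<^bsub>H\<^esub> x = \<one>\<^bsub>H\<^esub> \<Longrightarrow> x = \<one>\<^bsub>H\<^esub>"
proof -
  interpret group H by fact
  obtain h where h: "h \<in> iso H (free_Abelian_group S)"
    using assms(2) by (auto simp: is_iso_def)
  then have hom: "h \<in> hom H (free_Abelian_group S)" and inj: "inj_on h (carrier H)"
    by (auto simp: iso_def bij_betw_def)
  have mult: "h (x \<otimes>\<^bsub>H\<^esub> y) = h x + h y" if "x \<in> carrier H" "y \<in> carrier H" for x y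
    using hom_mult[OF hom that] by simp
  have one: "h \<one>\<^bsub>H\<^esub> = 0"
    using mult[of "\<one>\<^bsub>H\<^esub>" "\<one>\<^bsub>H\<^esub>"] by simp
  show "comm_group H"
  proof (rule group_comm_groupI)
    fix x y assume xy: "x \<in> carrier H" "y \<in> carrier H"
    then have "h (x \<otimes>\<^bsub>H\<^esub> y) = h (y \<otimes>\<^bsub>H\<^esub> x)" by (simp add: mult)
    then show "x \<otimes>\<^bsub>H\<^esub> y = y \<otimes>\<^bsub>H\<^esub> x" using xy by (intro inj_onD[OF inj]) auto
  qed
  fix x assume x: "x \<in> carrier H" "x \<otimes>\<^bsub>H\<^esub> x = \<one>\<^bsub>H\<^esub>"
  then have "h x + h x = 0" using mult[of x x] one by simp
  then have "poly_mapping.lookup (h x) i + poly_mapping.lookup (h x) i = 0" for i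
    by (metis lookup_add lookup_zero)
  then have "h x = h \<one>\<^bsub>H\<^esub>" by (intro poly_mapping_eqI) (simp add: one)
  then show "x = \<one>\<^bsub>H\<^esub>" using x by (intro inj_onD[OF inj]) auto
qed

text \<open>Commutativity lets the product be regrouped coordinate by coordinate. Together with
  \<open>lattice_element_axis\<close> this describes the homomorphism from \<int>^d that maps the
  unit vectors to the basis.\<close>

lemma lattice_element_add:
  assumes "comm_group (period_group G \<Gamma>)" "range \<beta> \<subseteq> \<Gamma>"
  shows "lattice_element G \<Gamma> \<beta> (a + b) = lattice_element G \<Gamma> \<beta> a \<otimes>\<^bsub>aut_group G\<^esub> lattice_element G \<Gamma> \<beta> b"
proof -
  interpret comm_group "period_group G \<Gamma>" by fact
  have "\<beta> k \<in> carrier (period_group G \<Gamma>)" for k using assms(2) by auto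
  note cl = int_pow_closed[OF this] and add = int_pow_mult[OF this]
  show ?thesis
    unfolding lattice_element_def
    using finprod_multf[of "\<lambda>k. \<beta> k [^]\<^bsub>period_group G \<Gamma>\<^esub> (a $ k)" UNIV "\<lambda>k. \<beta> k [^]\<^bsub>period_group G \<Gamma>\<^esub> (b $ k)"] cl
    by (simp add: add Pi_def)
qed

lemma lattice_element_axis:
  assumes "comm_group (period_group G \<Gamma>)" "range \<beta> \<subseteq> \<Gamma>"
  shows "lattice_element G \<Gamma> \<beta> (axis k 1) = \<beta> k"
proof -
  interpret comm_group "period_group G \<Gamma>" by fact
  have cl: "\<beta> k \<in> carrier (period_group G \<Gamma>)" for k using assms(2) by auto
  have "\<beta> j [^]\<^bsub>period_group G \<Gamma>\<^esub> (axis k (1::int) $ j)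
      = (if k = j then \<beta> j else \<one>\<^bsub>period_group G \<Gamma>\<^esub>)" for j
    using int_pow_1[OF cl[of j]] by (simp add: axis_def)
  then show ?thesis
    unfolding lattice_element_def
    using finprod_singleton[of k UNIV \<beta>] cl by (simp add: Pi_def)
qed


section \<open>One vertex orbit\<close>

locale one_vertex_orbit =
  fixes G :: "('v, 'e) multigraph" and \<Gamma> :: "('v, 'e) auto set" and X :: "('v, 'e, 'd::finite) marking"
  assumes periodic: "periodic_graph CARD('d) G \<Gamma>"
    and one_orbit: "card (vertex_orbits G \<Gamma>) = 1"
    and marking: "marking_of G \<Gamma> X"
begin

text \<open>The only chosen vertex representative; every vertex is a unique translate of it.\<close>

definition root :: 'v where
  "root = vrep X (the_elem (vertex_orbits G \<Gamma>))"

definition elem :: "int^'d \<Rightarrow> ('v, 'e) auto" where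
  "elem = lattice_element G \<Gamma> (basis_of X)"

section \<open>The free action of the periods on vertices and edges\<close>

lemma subgroup_periods: "subgroup \<Gamma> (aut_group G)"
  using periodic by (simp add: periodic_graph_def)

lemma group_periods: "group (period_group G \<Gamma>)"
  using subgroup.subgroup_is_group[OF subgroup_periods group_aut_group] .

lemma comm_group_periods: "comm_group (period_group G \<Gamma>)"
  using iso_free_Abelian_group_comm[OF group_periods] periodic
  by (auto simp: periodic_graph_def)

lemma periods_closed:
  assumes "\<gamma> \<in> \<Gamma>" "\<delta> \<in> \<Gamma>"
  shows "(fst \<gamma> \<circ> fst \<delta>, snd \<gamma> \<circ> snd \<delta>) \<in> \<Gamma>"
  using subgroup.m_closed[OF subgroup_periods assms] by (simp add: mult_aut_group)

lemma id_period: "(id, id) \<in> \<Gamma>"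
  using subgroup.one_closed[OF subgroup_periods] by (simp add: one_aut_group)

lemma period_permutes:
  assumes "\<gamma> \<in> \<Gamma>"
  shows "fst \<gamma> permutes verts G" "snd \<gamma> permutes edges G"
    and "e \<in> edges G \<Longrightarrow> ends G (snd \<gamma> e) = fst \<gamma> ` ends G e"
  using subgroup.mem_carrier[OF subgroup_periods assms] by (auto simp: aut_group_def)

lemma period_inverse:
  assumes "\<gamma> \<in> \<Gamma>"
  obtains \<delta> where "\<delta> \<in> \<Gamma>" "\<And>v. fst \<delta> (fst \<gamma> v) = v" "\<And>v. fst \<gamma> (fst \<delta> v) = v"
    "\<And>e. snd \<delta> (snd \<gamma> e) = e" "\<And>e. snd \<gamma> (snd \<delta> e) = e"
proof -
  interpret group "aut_group G" by (rule group_aut_group)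
  let ?\<delta> = "inv\<^bsub>aut_group G\<^esub> \<gamma>"
  have "\<gamma> \<in> carrier (aut_group G)"
    using subgroup.mem_carrier[OF subgroup_periods assms] .
  then have "?\<delta> \<otimes>\<^bsub>aut_group G\<^esub> \<gamma> = \<one>\<^bsub>aut_group G\<^esub>" "\<gamma> \<otimes>\<^bsub>aut_group G\<^esub> ?\<delta> = \<one>\<^bsub>aut_group G\<^esub>"
    by simp_all
  then show ?thesis
    using that[of ?\<delta>] subgroup.m_inv_closed[OF subgroup_periods assms]
    by (simp add: mult_aut_group one_aut_group fun_eq_iff)
qed

text \<open>The quotient of the two periods fixes \<open>v\<close>, hence is the identity. This
  determines the action on edges as well, since a period is a pair of permutations.\<close>

lemma vertex_free:
  assumes "\<gamma> \<in> \<Gamma>" "\<delta> \<in> \<Gamma>" "v \<in> verts G" "fst \<gamma> v = fst \<delta> v"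
  shows "\<gamma> = \<delta>"
proof -
  obtain \<delta>' where \<delta>': "\<delta>' \<in> \<Gamma>" "\<And>v. fst \<delta>' (fst \<delta> v) = v" "\<And>v. fst \<delta> (fst \<delta>' v) = v"
    "\<And>e. snd \<delta>' (snd \<delta> e) = e" "\<And>e. snd \<delta> (snd \<delta>' e) = e"
    using period_inverse[OF assms(2)] by blast
  have "(fst \<delta>' \<circ> fst \<gamma>, snd \<delta>' \<circ> snd \<gamma>) = (id, id)"
    using periodic periods_closed[OF \<delta>'(1) assms(1)] assms(3,4) \<delta>'(2)[of v]
    unfolding periodic_graph_def one_aut_group by fastforce
  then have "fst \<delta>' (fst \<gamma> w) = w" "snd \<delta>' (snd \<gamma> e) = e" for w e
    by (simp_all add: fun_eq_iff)
  then have "fst \<gamma> w = fst \<delta> w" "snd \<gamma> e = snd \<delta> e" for w e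
    using \<delta>'(3)[of "fst \<gamma> w"] \<delta>'(5)[of "snd \<gamma> e"] by simp_all
  then show ?thesis by (simp add: prod_eq_iff fun_eq_iff)
qed

lemma ends_subset: "e \<in> edges G \<Longrightarrow> ends G e \<subseteq> verts G"
  and card_ends: "e \<in> edges G \<Longrightarrow> card (ends G e) = 2"
  using periodic by (auto simp: periodic_graph_def wf_multigraph_def)

text \<open>The quotient \<eta> of the two periods fixes or swaps the ends of \<open>e\<close>. In
  either case its square fixes a vertex, so the square is trivial, and then so is \<eta> by
  torsion-freeness.\<close>

lemma edge_free:
  assumes "\<gamma> \<in> \<Gamma>" "\<delta> \<in> \<Gamma>" "e \<in> edges G" "snd \<gamma> e = snd \<delta> e"
  shows "\<gamma> = \<delta>"
proof -
  obtain \<delta>' where \<delta>': "\<delta>' \<in> \<Gamma>" "\<And>v. fst \<delta>' (fst \<delta> v) = v" "\<And>v. fst \<delta> (fst \<delta>' v) = v"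
    "\<And>e. snd \<delta>' (snd \<delta> e) = e" "\<And>e. snd \<delta> (snd \<delta>' e) = e"
    using period_inverse[OF assms(2)] by blast
  define \<eta> where "\<eta> = (fst \<delta>' \<circ> fst \<gamma>, snd \<delta>' \<circ> snd \<gamma>)"
  have \<eta>: "\<eta> \<in> \<Gamma>" unfolding \<eta>_def using periods_closed[OF \<delta>'(1) assms(1)] .
  have "snd \<eta> e = e" using assms(4) \<delta>'(4) by (simp add: \<eta>_def)
  then have im: "fst \<eta> ` ends G e = ends G e"
    using period_permutes(3)[OF \<eta> assms(3)] by simp
  obtain v w where vw: "ends G e = {v, w}" "v \<noteq> w"
    using card_ends[OF assms(3)] by (auto simp: card_2_iff)
  have v: "v \<in> verts G" using ends_subset[OF assms(3)] vw by simp
  have "{fst \<eta> v, fst \<eta> w} = {v, w}" using im unfolding vw(1) by simp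
  then have "fst \<eta> v = v \<or> fst \<eta> v = w \<and> fst \<eta> w = v"
    unfolding doubleton_eq_iff by blast
  then have "fst \<eta> (fst \<eta> v) = v" by (elim disjE conjE) simp_all
  then have "(fst \<eta> \<circ> fst \<eta>, snd \<eta> \<circ> snd \<eta>) = (id, id)"
    using vertex_free[OF periods_closed[OF \<eta> \<eta>] id_period v] by simp
  then have "\<eta> = (id, id)"
    using iso_free_Abelian_group_torsion_free[OF group_periods, of "{..<CARD('d)}" \<eta>] \<eta> periodic
    by (simp add: periodic_graph_def mult_aut_group one_aut_group)
  then have "fst \<delta>' (fst \<gamma> v) = v"
    by (simp add: \<eta>_def fun_eq_iff)
  then have "fst \<gamma> v = fst \<delta> v" using \<delta>'(3)[of "fst \<gamma> v"] by simp
  then show ?thesis using vertex_free[OF assms(1,2) v] by blast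
qed

lemma vertex_orbits_eq: "vertex_orbits G \<Gamma> = {the_elem (vertex_orbits G \<Gamma>)}"
  by (rule card_1_singletonE[OF one_orbit]) simp

lemma vertex_orbit_eq:
  assumes "v \<in> verts G"
  shows "vertex_orbit G \<Gamma> v = the_elem (vertex_orbits G \<Gamma>)"
proof -
  have "vertex_orbit G \<Gamma> v \<in> vertex_orbits G \<Gamma>"
    using assms unfolding orbits_def by blast
  then show ?thesis using vertex_orbits_eq by blast
qed

lemma root_in_verts: "root \<in> verts G"
proof -
  obtain v where "v \<in> verts G" "the_elem (vertex_orbits G \<Gamma>) = vertex_orbit G \<Gamma> v"
    using vertex_orbits_eq unfolding orbits_def by blast
  moreover have "root \<in> the_elem (vertex_orbits G \<Gamma>)"
    using marking vertex_orbits_eq unfolding marking_of_def root_def by blast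
  ultimately show ?thesis
    using period_permutes(1) by (auto simp: orbit_def permutes_in_image)
qed

lemma vertex_cases:
  assumes "v \<in> verts G"
  obtains \<gamma> where "\<gamma> \<in> \<Gamma>" "v = fst \<gamma> root"
proof -
  have "v = fst (id, id) v" by simp
  then have "v \<in> vertex_orbit G \<Gamma> v"
    using id_period unfolding orbit_def by fastforce
  also have "\<dots> = vertex_orbit G \<Gamma> root"
    using vertex_orbit_eq assms root_in_verts by simp
  finally show ?thesis using that by (auto simp: orbit_def)
qed

section \<open>Integer coordinates of the periods\<close>

lemma basis_periods: "range (basis_of X) \<subseteq> \<Gamma>"
  using marking by (simp add: marking_of_def period_basis_def)

lemma elem_in_periods: "elem c \<in> \<Gamma>"
proof -
  interpret comm_group "period_group G \<Gamma>" by (rule comm_group_periods)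
  have "basis_of X k \<in> carrier (period_group G \<Gamma>)" for k using basis_periods by auto
  note int_pow_closed[OF this]
  then have "lattice_element G \<Gamma> (basis_of X) c \<in> carrier (period_group G \<Gamma>)"
    unfolding lattice_element_def by (intro finprod_closed) auto
  then show ?thesis by (simp add: elem_def)
qed

lemma bij_elem: "bij_betw elem UNIV \<Gamma>"
proof (rule bij_betwI')
  have "period_basis G \<Gamma> (basis_of X)" using marking by (simp add: marking_of_def)
  then have ex1: "\<exists>!c. \<gamma> = elem c" if "\<gamma> \<in> \<Gamma>" for \<gamma>
    using that by (simp only: period_basis_def elem_def)
  show "(elem a = elem b) = (a = b)" for a b
    using ex1[OF elem_in_periods[of a]] by auto
  show "\<exists>c\<in>UNIV. \<gamma> = elem c" if "\<gamma> \<in> \<Gamma>" for \<gamma>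
    using ex1[OF that] by blast
qed (rule elem_in_periods)

lemma elem_add: "elem (a + b) = elem a \<otimes>\<^bsub>aut_group G\<^esub> elem b"
  unfolding elem_def by (rule lattice_element_add[OF comm_group_periods basis_periods])

lemma elem_axis: "elem (axis k 1) = basis_of X k"
  unfolding elem_def by (rule lattice_element_axis[OF comm_group_periods basis_periods])

definition coord :: "('v, 'e) auto \<Rightarrow> int^'d" where
  "coord = inv_into UNIV elem"

lemma coord_elem [simp]: "coord (elem c) = c"
  using bij_elem by (simp add: coord_def bij_betw_def)

lemma elem_coord [simp]: "\<gamma> \<in> \<Gamma> \<Longrightarrow> elem (coord \<gamma>) = \<gamma>"
  using bij_elem by (simp add: coord_def bij_betw_inv_into_right)

lemma coord_mult: "\<gamma> \<in> \<Gamma> \<Longrightarrow> \<delta> \<in> \<Gamma> \<Longrightarrow> coord (\<gamma> \<otimes>\<^bsub>aut_group G\<^esub> \<delta>) = coord \<gamma> + coord \<delta>"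
  by (metis coord_elem elem_coord elem_add)

section \<open>Representative edges and the lifting function\<close>

lemma marked_edge:
  assumes "\<epsilon> \<in> edge_orbits G \<Gamma>"
  shows "erep X \<epsilon> \<in> edges G" "ends G (erep X \<epsilon>) = {root, terminus X \<epsilon>}"
    and "origin X \<epsilon> = root" "terminus X \<epsilon> \<in> verts G" "terminus X \<epsilon> \<noteq> root"
proof -
  have X: "erep X \<epsilon> \<in> \<epsilon>" "ends G (erep X \<epsilon>) = {origin X \<epsilon>, terminus X \<epsilon>}"
    "origin X \<epsilon> \<in> vrep X ` vertex_orbits G \<Gamma>"
    using assms marking by (simp_all add: marking_of_def)
  show e: "erep X \<epsilon> \<in> edges G"
  proof -
    obtain e where "e \<in> edges G" "\<epsilon> = {snd \<gamma> e |\<gamma>. \<gamma> \<in> \<Gamma>}"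
      using assms by (auto simp: orbits_def orbit_def)
    then obtain \<gamma> where "\<gamma> \<in> \<Gamma>" "erep X \<epsilon> = snd \<gamma> e" using X(1) by blast
    then show ?thesis using \<open>e \<in> edges G\<close> permutes_in_image[OF period_permutes(2)] by simp
  qed
  show o: "origin X \<epsilon> = root"
    using X(3) unfolding root_def by (subst (asm) vertex_orbits_eq) simp
  show *: "ends G (erep X \<epsilon>) = {root, terminus X \<epsilon>}" using X(2) o by simp
  show "terminus X \<epsilon> \<in> verts G" using ends_subset[OF e] * by auto
  \<comment> \<open>All edges become loops in the quotient, but in \<open>G\<close> the two ends
    differ. This is what later tells the two attachment points of a bar apart.\<close>
  show "terminus X \<epsilon> \<noteq> root" using card_ends[OF e] * by auto
qed

text \<open>Justifies the definite description in \<open>lifting\<close>: some period carries the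
  root to the terminus, and it is unique because the action is free and coordinates are
  unique.\<close>

lemma terminus_eq:
  assumes "\<epsilon> \<in> edge_orbits G \<Gamma>"
  shows "terminus X \<epsilon> = fst (elem (lifting G \<Gamma> X \<epsilon>)) root"
proof -
  note t = marked_edge(4)[OF assms]
  obtain \<gamma> where \<gamma>: "\<gamma> \<in> \<Gamma>" "terminus X \<epsilon> = fst \<gamma> root"
    using vertex_cases[OF t] .
  have rep: "vrep X (vertex_orbit G \<Gamma> (terminus X \<epsilon>)) = root"
    using vertex_orbit_eq[OF t] by (simp add: root_def)
  have "terminus X \<epsilon> = fst (elem (coord \<gamma>)) root"
    using \<gamma> by simp
  moreover have "c = coord \<gamma>" if "terminus X \<epsilon> = fst (elem c) root" for c
    using that \<gamma> vertex_free[OF elem_in_periods \<gamma>(1) root_in_verts] by (metis coord_elem)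
  ultimately show ?thesis
    unfolding lifting_def rep elem_def[symmetric] by (rule theI)
qed

section \<open>Edges and vertices as unique translates of representatives\<close>

definition edge_orbit :: "'e \<Rightarrow> 'e set" where
  "edge_orbit = orbit (period_group G \<Gamma>) snd"

text \<open>Unique because the periods act freely on edges. It carries data given on the
  representative edge over to the whole orbit.\<close>

definition mover :: "'e \<Rightarrow> ('v, 'e) auto" where
  "mover e = (THE \<gamma>. \<gamma> \<in> \<Gamma> \<and> e = snd \<gamma> (erep X (edge_orbit e)))"

definition position :: "'v \<Rightarrow> ('v, 'e) auto" where
  "position v = (THE \<gamma>. \<gamma> \<in> \<Gamma> \<and> v = fst \<gamma> root)"

lemma edge_orbit_in: "e \<in> edges G \<Longrightarrow> edge_orbit e \<in> edge_orbits G \<Gamma>"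
  unfolding orbits_def edge_orbit_def by blast

lemma edge_orbit_translate:
  assumes "\<gamma> \<in> \<Gamma>"
  shows "edge_orbit (snd \<gamma> e) = edge_orbit e"
proof -
  have sub: "edge_orbit (snd \<delta> f) \<subseteq> edge_orbit f" if "\<delta> \<in> \<Gamma>" for \<delta> f
  proof
    fix x assume "x \<in> edge_orbit (snd \<delta> f)"
    then obtain \<eta> where "\<eta> \<in> \<Gamma>" "x = snd \<eta> (snd \<delta> f)" by (auto simp: edge_orbit_def orbit_def)
    then show "x \<in> edge_orbit f"
      using periods_closed[of \<eta> \<delta>] that unfolding edge_orbit_def orbit_def
      by (intro CollectI exI[of _ "(fst \<eta> \<circ> fst \<delta>, snd \<eta> \<circ> snd \<delta>)"]) simp
  qed
  obtain \<delta> where "\<delta> \<in> \<Gamma>" "snd \<delta> (snd \<gamma> e) = e" using period_inverse[OF assms] by metis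
  then show ?thesis using sub[OF assms, of e] sub[of \<delta> "snd \<gamma> e"] by simp
qed

lemma edge_orbit_erep:
  assumes "\<epsilon> \<in> edge_orbits G \<Gamma>"
  shows "edge_orbit (erep X \<epsilon>) = \<epsilon>"
proof -
  obtain e where e: "\<epsilon> = edge_orbit e" using assms by (auto simp: orbits_def edge_orbit_def)
  moreover have "erep X \<epsilon> \<in> \<epsilon>" using assms marking by (simp add: marking_of_def)
  ultimately obtain \<gamma> where "\<gamma> \<in> \<Gamma>" "erep X \<epsilon> = snd \<gamma> e" by (auto simp: edge_orbit_def orbit_def)
  then show ?thesis using edge_orbit_translate e by simp
qed

lemma mover_eq:
  assumes "\<gamma> \<in> \<Gamma>" "\<epsilon> \<in> edge_orbits G \<Gamma>"
  shows "mover (snd \<gamma> (erep X \<epsilon>)) = \<gamma>"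
  unfolding mover_def edge_orbit_translate[OF assms(1)] edge_orbit_erep[OF assms(2)]
proof (rule the_equality)
  fix \<delta> assume "\<delta> \<in> \<Gamma> \<and> snd \<gamma> (erep X \<epsilon>) = snd \<delta> (erep X \<epsilon>)"
  then show "\<delta> = \<gamma>" by (intro edge_free[OF _ assms(1) marked_edge(1)[OF assms(2)]]) simp_all
qed (simp add: assms(1))

lemma edge_cases:
  assumes "e \<in> edges G"
  obtains \<gamma> \<epsilon> where "\<gamma> \<in> \<Gamma>" "\<epsilon> \<in> edge_orbits G \<Gamma>" "e = snd \<gamma> (erep X \<epsilon>)"
proof -
  have "erep X (edge_orbit e) \<in> edge_orbit e"
    using edge_orbit_in[OF assms] marking by (simp add: marking_of_def)
  then obtain \<delta> where \<delta>: "\<delta> \<in> \<Gamma>" "erep X (edge_orbit e) = snd \<delta> e"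
    by (auto simp: edge_orbit_def orbit_def)
  obtain \<gamma> where "\<gamma> \<in> \<Gamma>" "snd \<gamma> (snd \<delta> e) = e" using period_inverse[OF \<delta>(1)] by metis
  then show ?thesis using that[OF _ edge_orbit_in[OF assms]] \<delta>(2) by metis
qed

lemma position_eq:
  assumes "\<gamma> \<in> \<Gamma>"
  shows "position (fst \<gamma> root) = \<gamma>"
  unfolding position_def
proof (rule the_equality)
  fix \<delta> assume "\<delta> \<in> \<Gamma> \<and> fst \<gamma> root = fst \<delta> root"
  then show "\<delta> = \<gamma>" by (intro vertex_free[OF _ assms root_in_verts]) simp_all
qed (simp add: assms)

lemma position_translate:
  assumes "\<gamma> \<in> \<Gamma>" "\<delta> \<in> \<Gamma>"
  shows "position (fst \<gamma> (fst \<delta> root)) = \<gamma> \<otimes>\<^bsub>aut_group G\<^esub> \<delta>"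
  using position_eq[OF periods_closed[OF assms]] by (simp add: mult_aut_group)

section \<open>The standard integer lattice and frameworks with prescribed bar vectors\<close>

definition lattice_vector :: "('v, 'e) auto \<Rightarrow> real^'d" where
  "lattice_vector \<gamma> = real_of_int_vec (coord \<gamma>)"

lemma lattice_vector_mult:
  "\<gamma> \<in> \<Gamma> \<Longrightarrow> \<delta> \<in> \<Gamma> \<Longrightarrow>
    lattice_vector (\<gamma> \<otimes>\<^bsub>aut_group G\<^esub> \<delta>) = lattice_vector \<gamma> + lattice_vector \<delta>"
  by (simp add: lattice_vector_def coord_mult real_of_int_vec_def vec_eq_iff)

lemma lattice_vector_id: "lattice_vector (id, id) = 0"
  using lattice_vector_mult[OF id_period id_period] by (simp add: mult_aut_group)

text \<open>Makes the lattice matrix the identity when \<open>lattice_vector\<close> is the period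
  map.\<close>

lemma lattice_vector_basis: "lattice_vector (basis_of X k) = axis k 1"
  unfolding elem_axis[symmetric] lattice_vector_def
  by (simp add: real_of_int_vec_def axis_def vec_eq_iff)

lemma inj_lattice_vector: "inj_on lattice_vector \<Gamma>"
proof (rule inj_onI)
  fix \<gamma> \<delta> assume "\<gamma> \<in> \<Gamma>" "\<delta> \<in> \<Gamma>" and "lattice_vector \<gamma> = lattice_vector \<delta>"
  then have "coord \<gamma> = coord \<delta>" by (simp add: lattice_vector_def real_of_int_vec_def vec_eq_iff)
  then have "elem (coord \<gamma>) = elem (coord \<delta>)" by simp
  then show "\<gamma> = \<delta>" using \<open>\<gamma> \<in> \<Gamma>\<close> \<open>\<delta> \<in> \<Gamma>\<close> by simp
qed

lemma full_rank_lattice_vectors: "full_rank_lattice (lattice_vector ` \<Gamma>)"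
  unfolding full_rank_lattice_def
proof (intro exI[of _ "\<lambda>k. axis k 1"] conjI)
  show "inj (\<lambda>k. axis k 1 :: real^'d)" by (rule injI) (simp add: axis_eq_axis)
  show "independent (range (\<lambda>k. axis k 1 :: real^'d))"
    by (rule independent_mono[OF independent_Basis]) (auto simp: axis_in_Basis_iff)
  have "c \<in> coord ` \<Gamma>" for c
    using imageI[OF elem_in_periods, of coord c] by simp
  then have "coord ` \<Gamma> = UNIV" by blast
  moreover have "lattice_vector ` \<Gamma> = real_of_int_vec ` coord ` \<Gamma>"
    by (simp add: lattice_vector_def image_image)
  ultimately have "lattice_vector ` \<Gamma> = range real_of_int_vec" by simp
  also have "real_of_int_vec = (\<lambda>c :: int^'d. \<Sum>k\<in>UNIV. of_int (c $ k) *\<^sub>R axis k 1)"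
    by (auto simp: fun_eq_iff real_of_int_vec_def vec_eq_iff axis_def if_distrib cong: if_cong)
  finally show "lattice_vector ` \<Gamma> = range (\<lambda>c :: int^'d. \<Sum>k\<in>UNIV. of_int (c $ k) *\<^sub>R axis k 1)" .
qed

text \<open>
  With \<open>\<Lambda> = I\<close>, a bar with period \<open>c\<close> that is attached at \<open>0\<close> to its origin and at \<open>b - c\<close> to its
  terminus has the vector \<open>b\<close>.
\<close>

definition bar_presentation :: "('e set \<Rightarrow> real^'d) \<Rightarrow> ('v, 'e, 'd) presentation" where
  "bar_presentation b =
     \<lparr> body = (\<lambda>v. (lattice_vector (position v), mat 1)),
       period = lattice_vector,
       attach = (\<lambda>v e. if v = fst (mover e) (terminus X (edge_orbit e))
          then b (edge_orbit e) - real_of_int_vec (lifting G \<Gamma> X (edge_orbit e)) else 0) \<rparr>"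

text \<open>Since \<open>mover\<close> recovers \<gamma> and \<open>fst \<gamma>\<close> is
  injective, the test for being the terminus can be pulled back to the representative edge. The
  resulting value no longer mentions \<gamma>, which is the periodicity of the attachment
  points.\<close>

lemma attach_bar_presentation:
  assumes "\<gamma> \<in> \<Gamma>" "\<epsilon> \<in> edge_orbits G \<Gamma>"
  shows "attach (bar_presentation b) (fst \<gamma> v) (snd \<gamma> (erep X \<epsilon>)) =
     (if v = terminus X \<epsilon> then b \<epsilon> - real_of_int_vec (lifting G \<Gamma> X \<epsilon>) else 0)"
  using permutes_inj[OF period_permutes(1)[OF assms(1)]] assms
  by (simp add: bar_presentation_def mover_eq edge_orbit_translate edge_orbit_erep inj_eq)

lemma presentation_of_bar_presentation: "presentation_of G \<Gamma> (bar_presentation b)"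
  unfolding presentation_of_def
proof (intro conjI ballI)
  let ?P = "bar_presentation b"
  fix v assume "v \<in> verts G"
  show "body ?P v \<in> SE"
    by (simp add: bar_presentation_def SE_def rotation_matrix_def orthogonal_matrix_id)
next
  let ?P = "bar_presentation b"
  fix \<gamma> v assume \<gamma>: "\<gamma> \<in> \<Gamma>" and "v \<in> verts G"
  then obtain \<delta> where \<delta>: "\<delta> \<in> \<Gamma>" "v = fst \<delta> root" using vertex_cases by blast
  show "body ?P (fst \<gamma> v) = (fst (body ?P v) + period ?P \<gamma>, snd (body ?P v))"
    using \<gamma> \<delta>(1)
    by (simp add: \<delta>(2) bar_presentation_def position_eq position_translate lattice_vector_mult)
next
  let ?P = "bar_presentation b"
  fix \<gamma> e v assume \<gamma>: "\<gamma> \<in> \<Gamma>" and "e \<in> edges G"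
  then obtain \<delta> \<epsilon> where \<delta>: "\<delta> \<in> \<Gamma>" and \<epsilon>: "\<epsilon> \<in> edge_orbits G \<Gamma>" and e: "e = snd \<delta> (erep X \<epsilon>)"
    using edge_cases by blast
  \<comment> \<open>Pulling \<open>v\<close> back to the representative edge lets both attachment
    points be read off at the same vertex \<open>u\<close>.\<close>
  obtain u where "v = fst \<delta> u"
    using permutes_surj[OF period_permutes(1)[OF \<delta>]] by (rule surjE)
  then show "attach ?P (fst \<gamma> v) (snd \<gamma> e) = attach ?P v e"
    using attach_bar_presentation[OF periods_closed[OF \<gamma> \<delta>] \<epsilon>, of b u]
      attach_bar_presentation[OF \<delta> \<epsilon>, of b u]
    by (simp add: e)
qed (simp_all add: bar_presentation_def lattice_vector_mult inj_lattice_vector full_rank_lattice_vectors)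

text \<open>All frames are unrotated, so the translate by \<gamma> of a representative bar runs from
  \<open>lattice_vector \<gamma>\<close> to
  \<open>lattice_vector \<gamma> + b \<epsilon>\<close>.\<close>

lemma framework_bar_presentation:
  assumes "connected_multigraph G" and b: "\<And>\<epsilon>. \<epsilon> \<in> edge_orbits G \<Gamma> \<Longrightarrow> b \<epsilon> \<noteq> 0"
  shows "framework G \<Gamma> (bar_presentation b)"
  unfolding framework_def
proof (intro conjI ballI allI impI)
  let ?P = "bar_presentation b"
  fix e v w assume "e \<in> edges G" and vw: "ends G e = {v, w}"
  then obtain \<gamma> \<epsilon> where \<gamma>: "\<gamma> \<in> \<Gamma>" and \<epsilon>: "\<epsilon> \<in> edge_orbits G \<Gamma>" and e: "e = snd \<gamma> (erep X \<epsilon>)"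
    using edge_cases by blast
  have "ends G e = {fst \<gamma> root, fst \<gamma> (terminus X \<epsilon>)}"
    using period_permutes(3)[OF \<gamma> marked_edge(1)[OF \<epsilon>]] marked_edge(2)[OF \<epsilon>] e by simp
  moreover have "move (body ?P (fst \<gamma> root)) (attach ?P (fst \<gamma> root) e) = lattice_vector \<gamma>"
    using attach_bar_presentation[OF \<gamma> \<epsilon>, of b root] marked_edge(5)[OF \<epsilon>] \<gamma>
    by (simp add: e bar_presentation_def position_eq)
  moreover have "move (body ?P (fst \<gamma> (terminus X \<epsilon>))) (attach ?P (fst \<gamma> (terminus X \<epsilon>)) e)
      = lattice_vector \<gamma> + b \<epsilon>"
  proof -
    let ?c = "lifting G \<Gamma> X \<epsilon>"
    \<comment> \<open>The body at the terminus is displaced by the additional period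
      \<open>?c\<close>, which cancels the correction subtracted in its attachment point.\<close>
    have "position (fst \<gamma> (terminus X \<epsilon>)) = \<gamma> \<otimes>\<^bsub>aut_group G\<^esub> elem ?c"
      using position_translate[OF \<gamma> elem_in_periods] terminus_eq[OF \<epsilon>] by simp
    then have "body ?P (fst \<gamma> (terminus X \<epsilon>)) = (lattice_vector \<gamma> + real_of_int_vec ?c, mat 1)"
      using lattice_vector_mult[OF \<gamma> elem_in_periods[of ?c]]
      by (simp add: bar_presentation_def lattice_vector_def)
    then show ?thesis
      using attach_bar_presentation[OF \<gamma> \<epsilon>, of b "terminus X \<epsilon>"] by (simp add: e)
  qed
  ultimately show "move (body ?P v) (attach ?P v e) \<noteq> move (body ?P w) (attach ?P w e)"
    using vw b[OF \<epsilon>] by (auto simp: doubleton_eq_iff)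
qed (use periodic assms(1) presentation_of_bar_presentation in auto)

text \<open>The lattice matrix is the identity and the root already has the frame (0, I), so
  re-marking changes nothing and the bar vector is c + (b - c) - 0.\<close>

lemma bar_vector_bar_presentation:
  assumes "\<epsilon> \<in> edge_orbits G \<Gamma>"
  shows "bar_vector G \<Gamma> X (bar_presentation b) \<epsilon> = b \<epsilon>"
proof -
  let ?P = "bar_presentation b"
  have L: "lattice_matrix X ?P = mat 1"
    by (simp add: lattice_matrix_def bar_presentation_def lattice_vector_basis transpose_def
        axis_def mat_def vec_eq_iff)
  have "vrep X (vertex_orbit G \<Gamma> v) = root" if "v \<in> verts G" for v
    using vertex_orbit_eq[OF that] by (simp add: root_def)
  moreover have "body ?P root = (0, mat 1)"
    using position_eq[OF id_period] by (simp add: bar_presentation_def lattice_vector_id)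
  ultimately have "marked_attach G \<Gamma> X ?P v (erep X \<epsilon>) = attach ?P v (erep X \<epsilon>)"
    if "v \<in> verts G" for v
    using that by (simp add: marked_attach_def)
  then show ?thesis
    using attach_bar_presentation[OF id_period assms, of b] marked_edge[OF assms] root_in_verts
    by (simp add: bar_vector_def L)
qed

text \<open>With one vertex orbit the required rank is d^2, here the number of edge orbits, so
  rigidity means that the tensors are independent.\<close>

lemma infinitesimally_rigid_iff:
  assumes "card (edge_orbits G \<Gamma>) = CARD('d)\<^sup>2"
  shows "infinitesimally_rigid G \<Gamma> X P \<longleftrightarrow>
     dim ((\<lambda>\<epsilon>. outer (bar_vector G \<Gamma> X P \<epsilon>) (real_of_int_vec (lifting G \<Gamma> X \<epsilon>))) ` edge_orbits G \<Gamma>)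
       = card (edge_orbits G \<Gamma>)"
proof -
  have "rigidity_rank G \<Gamma> X P =
     dim ((\<lambda>\<epsilon>. outer (bar_vector G \<Gamma> X P \<epsilon>) (real_of_int_vec (lifting G \<Gamma> X \<epsilon>))) ` edge_orbits G \<Gamma>)"
    using vertex_orbits_eq marked_edge vertex_orbit_eq root_in_verts
    by (intro rigidity_rank_eq_dim[where a = "the_elem (vertex_orbits G \<Gamma>)"]) auto
  then show ?thesis using assms one_orbit by (simp add: infinitesimally_rigid_def)
qed

end

theorem theorem1:
  fixes G :: "('v, 'e) multigraph"
    and \<Gamma> :: "('v, 'e) auto set"
    and X :: "('v, 'e, 'd::finite) marking"
  assumes "periodic_graph CARD('d) G \<Gamma>"
    and "connected_multigraph G"
    and "card (vertex_orbits G \<Gamma>) = 1"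
    and "card (edge_orbits G \<Gamma>) = CARD('d)\<^sup>2"
    and "marking_of G \<Gamma> X"
  shows "(\<exists>P :: ('v, 'e, 'd) presentation. framework G \<Gamma> P \<and> infinitesimally_rigid G \<Gamma> X P)
    \<longleftrightarrow> (\<forall>F \<subseteq> edge_orbits G \<Gamma>.
           card F \<le> CARD('d) * dim (span ((\<lambda>\<epsilon>. real_of_int_vec (lifting G \<Gamma> X \<epsilon>)) ` F)))"
proof -
  interpret one_vertex_orbit G \<Gamma> X
    using assms by unfold_locales
  let ?E = "edge_orbits G \<Gamma>" and ?c = "\<lambda>\<epsilon>. real_of_int_vec (lifting G \<Gamma> X \<epsilon>)"
  have fin: "finite ?E" using assms(1) by (simp add: periodic_graph_def)
  show ?thesis
  proof
    assume "\<exists>P :: ('v, 'e, 'd) presentation. framework G \<Gamma> P \<and> infinitesimally_rigid G \<Gamma> X P"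
    then obtain P :: "('v, 'e, 'd) presentation" where "infinitesimally_rigid G \<Gamma> X P" by blast
    then have "dim ((\<lambda>\<epsilon>. outer (bar_vector G \<Gamma> X P \<epsilon>) (?c \<epsilon>)) ` ?E) = card ?E"
      using infinitesimally_rigid_iff[OF assms(4)] by blast
    from card_le_dim_if_independent_outer[OF fin this]
    show "\<forall>F \<subseteq> ?E. card F \<le> CARD('d) * dim (span (?c ` F))" by simp
  next
    assume "\<forall>F \<subseteq> ?E. card F \<le> CARD('d) * dim (span (?c ` F))"
    then have "\<And>F. F \<subseteq> ?E \<Longrightarrow> card F \<le> CARD('d) * dim (?c ` F)" by simp
    \<comment> \<open>The vectors \<open>b\<close> become the bars of the framework: being non-zero
      gives bars of non-zero length, and the independence of their tensors gives full rank.\<close>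
    then obtain b :: "'e set \<Rightarrow> real^'d" where b: "\<And>\<epsilon>. b \<epsilon> \<noteq> 0"
      "dim ((\<lambda>\<epsilon>. outer (b \<epsilon>) (?c \<epsilon>)) ` ?E) = card ?E"
      using ex_independent_outer[OF fin] by blast
    have "(\<lambda>\<epsilon>. outer (bar_vector G \<Gamma> X (bar_presentation b) \<epsilon>) (?c \<epsilon>)) ` ?E = (\<lambda>\<epsilon>. outer (b \<epsilon>) (?c \<epsilon>)) ` ?E"
      by (intro image_cong refl) (simp add: bar_vector_bar_presentation)
    then have "infinitesimally_rigid G \<Gamma> X (bar_presentation b)"
      using infinitesimally_rigid_iff[OF assms(4)] b(2) by simp
    moreover have "framework G \<Gamma> (bar_presentation b)"
      using framework_bar_presentation[OF assms(2)] b(1) by blast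
    ultimately show "\<exists>P :: ('v, 'e, 'd) presentation. framework G \<Gamma> P \<and> infinitesimally_rigid G \<Gamma> X P"
      by blast
  qed
qed

end
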